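(* Let $U$ be a nonempty set, $E$ a finite set, and $G=(F,E)$ a covering soft set over $U$, with associated soft covering approximation space $S=(U,C_G)$. Suppose that for all $e_1,e_2\in E$ the set $F(e_1)\cap F(e_2)$ is a finite union of elements of $C_G$. Then $K=\{X\subseteq U: S^-(X)=X\}$ is a topology on $U$.
   Context: A soft set over $U$ is a pair $G=(F,E)$ with $F:E\to P(U)$ a map into the power set of $U$. It is a covering soft set if $\bigcup_{e\in E}F(e)=U$ and $F(e)\neq\emptyset$ for every $e\in E$. Write $C_G=\{F(e):e\in E\}$; the pair $S=(U,C_G)$ is called a soft covering approximation space. For $x\in U$ the soft minimal description of $x$ is $Md_S(x)=\{F(e): e\in E,\ x\in F(e),\text{ and for all } a\in E,\ x\in F(a)\subseteq F(e)\text{ implies }F(a)=F(e)\}$, i.e. the family of inclusion-minimal members of $C_G$ containing $x$. For $X\subseteq U$ the soft covering lower approximation is $S_-(X)=\bigcup\{F(e): e\in E,\ F(e)\subseteq X\}$ and the soft covering upper approximation is $S^-(X)=S_-(X)\cup\bigcup_{x\in X\setminus S_-(X)}\ \bigcup_{L\in Md_S(x)}L$. The empty union (equal to $\emptyset$) counts as a finite union of elements of $C_G$. *)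

theory Defs
  imports "HOL-Analysis.Abstract_Topology"
begin

text \<open>A soft set \<open>G = (F, E)\<close> over \<open>U\<close> is given by a HOL function \<open>F\<close>, of which only the values on
  the parameter set \<open>E\<close> matter.\<close>

definition soft_set :: "'a set \<Rightarrow> ('e \<Rightarrow> 'a set) \<Rightarrow> 'e set \<Rightarrow> bool" where
  "soft_set U F E \<longleftrightarrow> F \<in> E \<rightarrow> Pow U"

definition covering_soft_set :: "'a set \<Rightarrow> ('e \<Rightarrow> 'a set) \<Rightarrow> 'e set \<Rightarrow> bool" where
  "covering_soft_set U F E \<longleftrightarrow>
     soft_set U F E \<and> (\<Union>e\<in>E. F e) = U \<and> (\<forall>e\<in>E. F e \<noteq> {})"

definition soft_cover :: "('e \<Rightarrow> 'a set) \<Rightarrow> 'e set \<Rightarrow> 'a set set" where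
  "soft_cover F E = {F e | e. e \<in> E}"

definition soft_Md :: "('e \<Rightarrow> 'a set) \<Rightarrow> 'e set \<Rightarrow> 'a \<Rightarrow> 'a set set" where
  "soft_Md F E x =
     {F e | e. e \<in> E \<and> x \<in> F e \<and> (\<forall>a\<in>E. x \<in> F a \<and> F a \<subseteq> F e \<longrightarrow> F a = F e)}"

definition soft_lower :: "('e \<Rightarrow> 'a set) \<Rightarrow> 'e set \<Rightarrow> 'a set \<Rightarrow> 'a set" where
  "soft_lower F E X = \<Union>{F e | e. e \<in> E \<and> F e \<subseteq> X}"

definition soft_upper :: "('e \<Rightarrow> 'a set) \<Rightarrow> 'e set \<Rightarrow> 'a set \<Rightarrow> 'a set" where
  "soft_upper F E X =
     soft_lower F E X \<union> (\<Union>x\<in>X - soft_lower F E X. \<Union>L\<in>soft_Md F E x. L)"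

definition finite_union_of_members :: "'a set set \<Rightarrow> 'a set \<Rightarrow> bool" where
  "finite_union_of_members C A \<longleftrightarrow> (\<exists>D. finite D \<and> D \<subseteq> C \<and> A = \<Union>D)"

text \<open>The library predicate \<^const>\<open>istopology\<close> does not mention the underlying set, and it
  yields the empty set as the union of the empty family.\<close>

definition topology_on_set :: "'a set \<Rightarrow> 'a set set \<Rightarrow> bool" where
  "topology_on_set U T \<longleftrightarrow> T \<subseteq> Pow U \<and> U \<in> T \<and> istopology (\<lambda>X. X \<in> T)"

end

(* Since E is finite, every point of U has a minimal description.  A point of X outside the lower
   approximation would bring a minimal member L into the upper approximation; if the latter is X,
   then L lies inside X and so inside the lower approximation, a contradiction.  Hence the fixed
   points of the upper approximation are exactly the unions of members of the cover, and the
   intersection hypothesis says that the cover is a base. *)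
theory Submission
  imports Defs
begin

text \<open>Only finitely many sets \<open>F e\<close> contain \<open>x\<close>, and a nonempty
  finite family has an inclusion-minimal element.\<close>

lemma soft_Md_nonempty:
  assumes "finite E" "e \<in> E" "x \<in> F e"
  shows "soft_Md F E x \<noteq> {}"
proof -
  let ?A = "F ` {e \<in> E. x \<in> F e}"
  have "finite ?A" "?A \<noteq> {}"
    using assms by auto
  then obtain L where "L \<in> ?A" and min: "\<forall>B\<in>?A. B \<subseteq> L \<longrightarrow> L = B"
    using finite_has_minimal[of ?A] by blast
  then have "L \<in> soft_Md F E x"
    unfolding soft_Md_def by auto
  then show ?thesis by blast
qed

text \<open>The right-hand side is the pointwise criterion for \<open>X\<close> to be a union of
  members, free of minimal descriptions; the topology axioms are checked in this form.\<close>

lemma soft_upper_fixed_iff: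
  assumes "finite E" "X \<subseteq> (\<Union>e\<in>E. F e)"
  shows "soft_upper F E X = X \<longleftrightarrow> (\<forall>x\<in>X. \<exists>e\<in>E. x \<in> F e \<and> F e \<subseteq> X)"
proof
  assume fixed: "soft_upper F E X = X"
  show "\<forall>x\<in>X. \<exists>e\<in>E. x \<in> F e \<and> F e \<subseteq> X"
  proof
    fix x assume "x \<in> X"
    then obtain e where "e \<in> E" "x \<in> F e"
      using assms(2) by blast
    then obtain L where L: "L \<in> soft_Md F E x"
      using soft_Md_nonempty[OF assms(1), of e x F] by auto
    then obtain a where a: "a \<in> E" "x \<in> F a" "L = F a"
      unfolding soft_Md_def by blast
    show "\<exists>e\<in>E. x \<in> F e \<and> F e \<subseteq> X"
    proof (cases "x \<in> soft_lower F E X")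
      case True
      then show ?thesis
        unfolding soft_lower_def by blast
    next
      case False
      \<comment> \<open>The minimal set \<open>L\<close> is itself the witness: it enters the upper
        approximation, which is \<open>X\<close> by \<open>fixed\<close>.\<close>
      then have "L \<subseteq> soft_upper F E X"
        using L \<open>x \<in> X\<close> unfolding soft_upper_def by blast
      then show ?thesis
        using a fixed by blast
    qed
  qed
next
  assume "\<forall>x\<in>X. \<exists>e\<in>E. x \<in> F e \<and> F e \<subseteq> X"
  \<comment> \<open>Hence \<open>X - soft_lower F E X\<close> is empty and minimal descriptions
    contribute nothing.\<close>
  then have "soft_lower F E X = X"
    unfolding soft_lower_def by blast
  then show "soft_upper F E X = X"
    unfolding soft_upper_def by simp
qed

theorem theorem25:
  fixes U :: "'a set" and E :: "'e set" and F :: "'e \<Rightarrow> 'a set"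
  assumes "U \<noteq> {}"
    and "finite E"
    and "covering_soft_set U F E"
    and "\<forall>e1\<in>E. \<forall>e2\<in>E. finite_union_of_members (soft_cover F E) (F e1 \<inter> F e2)"
  shows "topology_on_set U {X. X \<subseteq> U \<and> soft_upper F E X = X}"
proof -
  let ?open = "\<lambda>X. X \<subseteq> U \<and> (\<forall>x\<in>X. \<exists>e\<in>E. x \<in> F e \<and> F e \<subseteq> X)"
  have U: "(\<Union>e\<in>E. F e) = U"
    using assms(3) unfolding covering_soft_set_def by blast
  have K: "{X. X \<subseteq> U \<and> soft_upper F E X = X} = {X. ?open X}"
    \<comment> \<open>\<open>conj_cong\<close> supplies \<open>X \<subseteq> U\<close>, the
      remaining premise of the lemma.\<close>
    using soft_upper_fixed_iff[OF assms(2), of _ F] unfolding U by (intro Collect_cong conj_cong refl)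
  have inter: "?open (X \<inter> Y)" if X: "?open X" and Y: "?open Y" for X Y
  proof (intro conjI ballI)
    show "X \<inter> Y \<subseteq> U" using X by blast
    fix x assume x: "x \<in> X \<inter> Y"
    obtain e1 where e1: "e1 \<in> E" "x \<in> F e1" "F e1 \<subseteq> X"
      using X x by blast
    obtain e2 where e2: "e2 \<in> E" "x \<in> F e2" "F e2 \<subseteq> Y"
      using Y x by blast
    obtain D where D: "D \<subseteq> soft_cover F E" "F e1 \<inter> F e2 = \<Union>D"
      using assms(4)[rule_format, OF e1(1) e2(1)] unfolding finite_union_of_members_def by blast
    \<comment> \<open>One member of \<open>D\<close> around \<open>x\<close> suffices, since it lies
      in both \<open>F e1\<close> and \<open>F e2\<close>.\<close>
    then obtain L where L: "L \<in> D" "x \<in> L"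
      using e1(2) e2(2) by blast
    then obtain e where "e \<in> E" "L = F e"
      using D(1) unfolding soft_cover_def by blast
    moreover have "L \<subseteq> X \<inter> Y"
      using L(1) D(2) e1(3) e2(3) by blast
    ultimately show "\<exists>e\<in>E. x \<in> F e \<and> F e \<subseteq> X \<inter> Y"
      using L(2) by blast
  qed
  have union: "?open (\<Union>\<X>)" if \<X>: "\<forall>X\<in>\<X>. ?open X" for \<X>
  proof (intro conjI ballI)
    show "\<Union>\<X> \<subseteq> U" using \<X> by blast
    fix x assume "x \<in> \<Union>\<X>"
    then obtain X where X: "X \<in> \<X>" "x \<in> X" by blast
    then obtain e where "e \<in> E" "x \<in> F e" "F e \<subseteq> X"
      using \<X> by blast
    then show "\<exists>e\<in>E. x \<in> F e \<and> F e \<subseteq> \<Union>\<X>"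
      using X(1) by blast
  qed
  have "istopology ?open"
    \<comment> \<open>\<open>conjI\<close> is applied just once: \<open>?open\<close> is itself a
      conjunction and must stay whole to match \<open>inter\<close> and
      \<open>union\<close>.\<close>
    unfolding istopology_def by (rule conjI) (intro allI impI inter union; assumption)+
  moreover have "?open U"
    using U by blast
  ultimately show ?thesis
    unfolding topology_on_set_def K mem_Collect_eq by (intro conjI subsetI) simp_all
qed

end
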